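(* Let $D$ be a finite digraph on $n$ vertices, let $S$ be the set of sources of $D$ (vertices of indegree $0$), and let $N_D^+(S)=\bigl(\bigcup_{x\in S}N_D^+(x)\bigr)\setminus S$ and $N_D^+[S]=N_D^+(S)\cup S$. Suppose that $V(D)\setminus N_D^+[S]$ has a partition $V_1\cup V_2$ such that the induced subdigraph $D[V_i]$ is kernel-perfect for each $i=1,2$. Then $D$ has a quasi-kernel of size at most $\frac{n+|S|-|N_D^+(S)|}{2}$.
   Context: Digraphs are finite, have no loops, and may contain antiparallel arcs. For a vertex $x$, $N_D^+(x)=\{y: xy\in A(D)\}$. A set $K\subseteq V(D)$ is independent if no arc of $D$ joins two vertices of $K$. The distance ${\rm dist}_D(u,v)$ is the length of a shortest directed path from $u$ to $v$, and ${\rm dist}_D(K,v)=\min_{x\in K}{\rm dist}_D(x,v)$. A kernel of $D$ is an independent set $K$ with ${\rm dist}_D(K,v)=1$ for every $v\in V(D)\setminus K$. A quasi-kernel of $D$ is an independent set $K$ with ${\rm dist}_D(K,v)\le 2$ for every $v\in V(D)\setminus K$. A digraph is kernel-perfect if every induced subdigraph of it has a kernel. *)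

theory Defs
  imports
    Complex_Main
    "HOL-Library.Extended_Nat"
    "Graph_Theory.Digraph_Component"
begin

definition out_nbrs :: "('a, 'b) pre_digraph \<Rightarrow> 'a \<Rightarrow> 'a set" where
  "out_nbrs D x = {y. x \<rightarrow>\<^bsub>D\<^esub> y}"

definition sources :: "('a, 'b) pre_digraph \<Rightarrow> 'a set" where
  "sources D = {x \<in> verts D. in_degree D x = 0}"

definition set_out_nbrs :: "('a, 'b) pre_digraph \<Rightarrow> 'a set \<Rightarrow> 'a set" where
  "set_out_nbrs D S = (\<Union>x\<in>S. out_nbrs D x) - S"

definition closed_out_nbrs :: "('a, 'b) pre_digraph \<Rightarrow> 'a set \<Rightarrow> 'a set" where
  "closed_out_nbrs D S = set_out_nbrs D S \<union> S"

definition indep_set :: "('a, 'b) pre_digraph \<Rightarrow> 'a set \<Rightarrow> bool" where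
  "indep_set D K \<longleftrightarrow> K \<subseteq> verts D \<and> (\<forall>x\<in>K. \<forall>y\<in>K. \<not> x \<rightarrow>\<^bsub>D\<^esub> y)"

text \<open>
  Both distances are \<open>\<infinity>\<close> when the infimum is taken over the empty set, that is,
  when no path exists or when \<open>K\<close> is empty; otherwise the infimum is a minimum.
\<close>

definition distance :: "('a, 'b) pre_digraph \<Rightarrow> 'a \<Rightarrow> 'a \<Rightarrow> enat" where
  "distance D u v = (INF p\<in>{p. pre_digraph.apath D u p v}. enat (length p))"

definition set_distance :: "('a, 'b) pre_digraph \<Rightarrow> 'a set \<Rightarrow> 'a \<Rightarrow> enat" where
  "set_distance D K v = (INF x\<in>K. distance D x v)"

definition is_kernel :: "('a, 'b) pre_digraph \<Rightarrow> 'a set \<Rightarrow> bool" where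
  "is_kernel D K \<longleftrightarrow> indep_set D K \<and> (\<forall>v\<in>verts D - K. set_distance D K v = 1)"

definition is_quasi_kernel :: "('a, 'b) pre_digraph \<Rightarrow> 'a set \<Rightarrow> bool" where
  "is_quasi_kernel D K \<longleftrightarrow> indep_set D K \<and> (\<forall>v\<in>verts D - K. set_distance D K v \<le> 2)"

definition kernel_perfect :: "('a, 'b) pre_digraph \<Rightarrow> bool" where
  "kernel_perfect D \<longleftrightarrow> (\<forall>H. induced_subgraph H D \<longrightarrow> (\<exists>K. is_kernel H K))"

end

theory Submission
  imports Defs
begin

text \<open>
  Since \<open>S\<close> lies in every quasi-kernel, it suffices to find a set \<open>Q\<close> in the rest
  \<open>R = V\<^sub>1 \<union> V\<^sub>2\<close> with \<open>2 |Q| \<le> |R|\<close>. Vertices of \<open>V\<^sub>2\<close> without in-neighbours in \<open>V\<^sub>1\<close> can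
  be moved to \<open>V\<^sub>1\<close> without destroying kernel-perfectness, so a kernel \<open>K\<close> of \<open>D[V\<^sub>1]\<close> reaches
  all of \<open>R\<close> within distance 2. For the second set, move the vertices of \<open>V\<^sub>1 - K\<close> without
  in-neighbours in \<open>V\<^sub>2\<close> to \<open>V\<^sub>2\<close>, giving \<open>W\<close>, and let \<open>A\<close> be the vertices of \<open>K\<close> without
  in-neighbours in \<open>W\<close>. Then \<open>A\<close> together with a kernel of \<open>W - N\<^sup>+(A)\<close> is a
  quasi-kernel of \<open>D[R]\<close>. Finally thin out \<open>A \<subseteq> K\<close> to a minimal \<open>B \<subseteq> A\<close> such that
  \<open>(K - A) \<union> B\<close> has the same out-neighbours as \<open>K\<close>. What is lost is still at distance 2,
  except for sources of \<open>D[R]\<close>, which are at distance 2 from \<open>S\<close>. The two sets now share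
  only \<open>B\<close>, and each vertex of \<open>B\<close> has a private out-neighbour outside both sets, so their
  sizes add up to at most \<open>|R|\<close>.
\<close>

text \<open>A relation and a vertex set stand in for an induced subdigraph, so that passing to a
  subset changes only \<open>X\<close>.\<close>

definition kernel_on :: "('a \<Rightarrow> 'a \<Rightarrow> bool) \<Rightarrow> 'a set \<Rightarrow> 'a set \<Rightarrow> bool" where
  "kernel_on E X K \<longleftrightarrow>
    K \<subseteq> X \<and> (\<forall>x\<in>K. \<forall>y\<in>K. \<not> E x y) \<and> (\<forall>v\<in>X - K. \<exists>k\<in>K. E k v)"

definition kernel_perfect_on :: "('a \<Rightarrow> 'a \<Rightarrow> bool) \<Rightarrow> 'a set \<Rightarrow> bool" where
  "kernel_perfect_on E X \<longleftrightarrow> (\<forall>Y\<subseteq>X. \<exists>K. kernel_on E Y K)"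

definition within_two :: "('a \<Rightarrow> 'a \<Rightarrow> bool) \<Rightarrow> 'a set \<Rightarrow> 'a \<Rightarrow> bool" where
  "within_two E Q v \<longleftrightarrow>
    v \<in> Q \<or> (\<exists>q\<in>Q. E q v) \<or> (\<exists>q\<in>Q. \<exists>w. E q w \<and> E w v)"

section \<open>Kernel-perfect sets of a relation\<close>

lemma kernel_perfect_on_subset:
  "kernel_perfect_on E X \<Longrightarrow> Y \<subseteq> X \<Longrightarrow> kernel_perfect_on E Y"
  by (auto simp: kernel_perfect_on_def)

text \<open>A kernel \<open>A\<close> of \<open>U \<inter> Y\<close> can be chosen first, because
  nothing picked later in \<open>X\<close> has an arc into it. A kernel of what remains of
  \<open>U\<close> outside \<open>Y\<close> and undominated by \<open>A\<close> completes
  it.\<close>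

lemma kernel_perfect_on_Un:
  assumes X: "kernel_perfect_on E X" and Y: "kernel_perfect_on E Y"
    and no_arc: "\<And>x y. x \<in> X \<Longrightarrow> y \<in> Y \<Longrightarrow> \<not> E x y"
  shows "kernel_perfect_on E (X \<union> Y)"
  unfolding kernel_perfect_on_def
proof (intro allI impI)
  fix U assume U: "U \<subseteq> X \<union> Y"
  obtain A where A: "kernel_on E (U \<inter> Y) A"
    using Y unfolding kernel_perfect_on_def by (meson inf_le2)
  have "(U \<inter> X) - Y - {v. \<exists>a\<in>A. E a v} \<subseteq> X" by blast
  then obtain B where B: "kernel_on E ((U \<inter> X) - Y - {v. \<exists>a\<in>A. E a v}) B"
    using X unfolding kernel_perfect_on_def by blast
  have AY: "A \<subseteq> U \<inter> Y" and AA: "\<And>x y. x \<in> A \<Longrightarrow> y \<in> A \<Longrightarrow> \<not> E x y"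
    and Adom: "\<And>v. v \<in> U \<Longrightarrow> v \<in> Y \<Longrightarrow> v \<notin> A \<Longrightarrow> \<exists>k\<in>A. E k v"
    using A unfolding kernel_on_def by auto
  have BX: "B \<subseteq> U \<inter> X" and BB: "\<And>x y. x \<in> B \<Longrightarrow> y \<in> B \<Longrightarrow> \<not> E x y"
    and AB: "\<And>x y. x \<in> A \<Longrightarrow> y \<in> B \<Longrightarrow> \<not> E x y"
    and Bdom: "\<And>v. v \<in> U \<Longrightarrow> v \<in> X \<Longrightarrow> v \<notin> Y \<Longrightarrow> \<not> (\<exists>a\<in>A. E a v) \<Longrightarrow> v \<notin> B
      \<Longrightarrow> \<exists>k\<in>B. E k v"
    using B unfolding kernel_on_def by auto
  have BA: "\<not> E x y" if "x \<in> B" "y \<in> A" for x y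
    using that AY BX no_arc by blast
  have "\<exists>k\<in>A \<union> B. E k v" if "v \<in> U - (A \<union> B)" for v
    using that U Adom[of v] Bdom[of v] by blast
  then have "kernel_on E U (A \<union> B)"
    unfolding kernel_on_def using AY BX AA AB BA BB by blast
  then show "\<exists>K. kernel_on E U K" by blast
qed

text \<open>If \<open>B\<close> is inclusion-minimal, dropping \<open>b\<close> loses some
  out-neighbour, and that one is private to \<open>b\<close>.\<close>

lemma minimal_subset_same_image:
  assumes "finite A"
  obtains B where "B \<subseteq> A" "\<And>v. (\<exists>a\<in>C \<union> A. E a v) \<Longrightarrow> \<exists>b\<in>C \<union> B. E b v"
    "\<And>b. b \<in> B \<Longrightarrow> \<exists>v. E b v \<and> (\<forall>b'\<in>C \<union> B - {b}. \<not> E b' v)"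
proof -
  let ?P = "\<lambda>B. B \<subseteq> A \<and> (\<forall>v. (\<exists>a\<in>C \<union> A. E a v) \<longrightarrow> (\<exists>b\<in>C \<union> B. E b v))"
  have "finite {B. ?P B}" "A \<in> {B. ?P B}"
    using finite_subset[of "{B. ?P B}" "Pow A"] assms by auto
  from finite_has_minimal2[OF this]
  obtain B where B: "?P B" and min: "\<And>B'. ?P B' \<Longrightarrow> B' \<subseteq> B \<Longrightarrow> B = B'" by auto
  have "\<exists>v. E b v \<and> (\<forall>b'\<in>C \<union> B - {b}. \<not> E b' v)" if b: "b \<in> B" for b
  proof (rule ccontr)
    assume "\<not> ?thesis"
    then have *: "\<exists>b'\<in>C \<union> B - {b}. E b' v" if "E b v" for v using that by blast
    have "\<exists>b'\<in>C \<union> (B - {b}). E b' v" if v: "\<exists>a\<in>C \<union> A. E a v" for v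
    proof -
      obtain c where "c \<in> C \<union> B" "E c v" using B v by blast
      then show ?thesis using *[of v] by (cases "c = b") blast+
    qed
    then have "?P (B - {b})" using B by auto
    then show False using min[of "B - {b}"] b by blast
  qed
  then show ?thesis using that[of B] B by blast
qed

text \<open>Bounding the sum of the sizes lets the smaller set be chosen afterwards.
  \<open>P\<close> is a thinned-out kernel of \<open>V1\<close> and may miss vertices without
  in-neighbours, hence its weaker claim.\<close>

lemma two_sets_within_two:
  assumes fin: "finite (V1 \<union> V2)" and disj: "V1 \<inter> V2 = {}"
    and kp1: "kernel_perfect_on E V1" and kp2: "kernel_perfect_on E V2"
    and closed: "\<And>u v. E u v \<Longrightarrow> u \<in> V1 \<union> V2 \<and> v \<in> V1 \<union> V2"
    and inn: "\<And>v. v \<in> V2 \<Longrightarrow> \<exists>u\<in>V1. E u v"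
  obtains P Q where "P \<subseteq> V1 \<union> V2" "Q \<subseteq> V1 \<union> V2"
    "\<And>x y. x \<in> P \<Longrightarrow> y \<in> P \<Longrightarrow> \<not> E x y" "\<And>x y. x \<in> Q \<Longrightarrow> y \<in> Q \<Longrightarrow> \<not> E x y"
    "\<And>u v. E u v \<Longrightarrow> within_two E P v"
    "\<And>v. v \<in> V1 \<union> V2 \<Longrightarrow> within_two E Q v"
    "card P + card Q \<le> card (V1 \<union> V2)"
proof -
  obtain K where K: "kernel_on E V1 K"
    using kp1 unfolding kernel_perfect_on_def by blast
  have KV: "K \<subseteq> V1" and KK: "\<And>x y. x \<in> K \<Longrightarrow> y \<in> K \<Longrightarrow> \<not> E x y"
    and Kdom: "\<And>v. v \<in> V1 \<Longrightarrow> v \<notin> K \<Longrightarrow> \<exists>k\<in>K. E k v"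
    using K unfolding kernel_on_def by auto
  define Z where "Z = {v \<in> V1 - K. \<forall>u\<in>V2. \<not> E u v}"
  define W where "W = V2 \<union> Z"
  define A where "A = {k \<in> K. \<forall>u\<in>W. \<not> E u k}"
  have kpW: "kernel_perfect_on E W"
    unfolding W_def
    by (intro kernel_perfect_on_Un kp2 kernel_perfect_on_subset[OF kp1]) (auto simp: Z_def)
  have WK: "W \<inter> K = {}" using KV disj by (auto simp: W_def Z_def)
  have WV: "W \<subseteq> V1 \<union> V2" by (auto simp: W_def Z_def)
  have AK: "A \<subseteq> K" by (auto simp: A_def)
  obtain M where M: "kernel_on E (W - {v. \<exists>a\<in>A. E a v}) M"
    using kpW unfolding kernel_perfect_on_def by (meson Diff_subset)
  have MW: "M \<subseteq> W" and MM: "\<And>x y. x \<in> M \<Longrightarrow> y \<in> M \<Longrightarrow> \<not> E x y"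
    and AM: "\<And>x y. x \<in> A \<Longrightarrow> y \<in> M \<Longrightarrow> \<not> E x y"
    and Mdom: "\<And>v. v \<in> W \<Longrightarrow> \<not> (\<exists>a\<in>A. E a v) \<Longrightarrow> v \<notin> M \<Longrightarrow> \<exists>k\<in>M. E k v"
    using M unfolding kernel_on_def by auto
  have "finite A" using AK KV fin by (meson finite_Un finite_subset)
  from minimal_subset_same_image[OF this, of "K - A" E]
  obtain B where BA: "B \<subseteq> A"
    and same: "\<And>v. (\<exists>a\<in>K - A \<union> A. E a v) \<Longrightarrow> \<exists>b\<in>K - A \<union> B. E b v"
    and priv: "\<And>b. b \<in> B \<Longrightarrow> \<exists>v. E b v \<and> (\<forall>b'\<in>K - A \<union> B - {b}. \<not> E b' v)"
    by blast
  define P where "P = K - A \<union> B"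
  define Q where "Q = A \<union> M"
  have PK: "P \<subseteq> K" using AK BA by (auto simp: P_def)
  have same': "\<exists>b\<in>P. E b v" if "k \<in> K" "E k v" for k v
    using same[of v] that unfolding P_def by blast
  have Pdom1: "\<exists>b\<in>P. E b v" if "v \<in> V1 - K" for v
    using that Kdom[of v] same' by blast
  \<comment> \<open>The arc into \<open>v\<close> matters only for a vertex lost in thinning: it
    lies in \<open>A\<close>, so its in-neighbour avoids \<open>W\<close> and \<open>K\<close> and
    is thus a vertex of \<open>V1 - K\<close>, which \<open>P\<close> dominates.\<close>
  have P2: "within_two E P v" if uv: "E u v" for u v
  proof (cases "v \<in> V2")
    case True
    then obtain w where "w \<in> V1" "E w v" using inn by blast
    then show ?thesis
      using Pdom1[of w] same'[of w v] unfolding within_two_def by blast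
  next
    case False
    then have v1: "v \<in> V1" using closed[OF uv] by blast
    show ?thesis
    proof (cases "v \<in> K - P")
      case True
      then have vA: "v \<in> A" by (auto simp: P_def)
      then have "u \<notin> W" "u \<notin> K" using uv KK AK by (auto simp: A_def)
      then have "u \<in> V1 - K" using closed[OF uv] by (auto simp: W_def)
      then show ?thesis using Pdom1 uv unfolding within_two_def by blast
    next
      case False
      then show ?thesis using Pdom1 v1 unfolding within_two_def by blast
    qed
  qed
  have QW: "v \<in> Q \<or> (\<exists>q\<in>Q. E q v)" if "v \<in> W" for v
    using Mdom[OF that] unfolding Q_def by blast
  have Q2: "within_two E Q v" if v: "v \<in> V1 \<union> V2" for v
  proof -
    \<comment> \<open>Outside \<open>W\<close> and \<open>A\<close>, a vertex of \<open>K\<close>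
      has an in-neighbour in \<open>W\<close> by the choice of \<open>A\<close>, and one of
      \<open>V1 - K\<close> has an in-neighbour in \<open>V2\<close> by the choice of
      \<open>Z\<close>.\<close>
    consider "v \<in> W" | "v \<in> A" | u where "u \<in> W" "E u v"
      using v unfolding W_def A_def Z_def by blast
    then show ?thesis
    proof cases
      case 3
      then show ?thesis using QW[of u] unfolding within_two_def by blast
    qed (use QW in \<open>auto simp: within_two_def Q_def\<close>)
  qed
  obtain f where f: "\<And>b. b \<in> B \<Longrightarrow> E b (f b) \<and> (\<forall>b'\<in>P - {b}. \<not> E b' (f b))"
    using priv unfolding P_def by metis
  have BP: "B \<subseteq> P" by (auto simp: P_def)
  have inj: "inj_on f B"
    using f BP by (intro inj_onI) (metis DiffI empty_iff insert_iff subsetD)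
  \<comment> \<open>Private out-neighbours avoid \<open>K\<close> by independence and
    \<open>M\<close> because \<open>M\<close> was chosen outside the out-neighbours of
    \<open>A\<close>.\<close>
  have fV: "f ` B \<subseteq> (V1 \<union> V2) - (P \<union> Q)"
  proof
    fix v assume "v \<in> f ` B"
    then obtain b where b: "b \<in> B" "v = f b" by blast
    then have "E b v" "b \<in> A" "b \<in> K" using f BA AK by auto
    then have "v \<notin> K" "v \<notin> M" "v \<in> V1 \<union> V2" using KK AM closed by blast+
    then show "v \<in> (V1 \<union> V2) - (P \<union> Q)" using b PK AK unfolding Q_def by blast
  qed
  have PQV: "P \<union> Q \<subseteq> V1 \<union> V2" using PK AK KV MW WV unfolding Q_def by blast
  have finPQ: "finite (P \<union> Q)" using PQV fin finite_subset by blast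
  \<comment> \<open>\<open>P\<close> lies in \<open>K\<close>, which misses \<open>W\<close> and
    hence \<open>M\<close>; so the overlap lies in \<open>A\<close>, and \<open>P\<close> keeps only
    \<open>B\<close> of \<open>A\<close>.\<close>
  have PQB: "P \<inter> Q \<subseteq> B" using PK MW WK unfolding P_def Q_def by blast
  have "finite B" using BP finPQ by (meson finite_Un finite_subset)
  then have "card (P \<inter> Q) \<le> card (f ` B)"
    using PQB inj by (simp add: card_image card_mono)
  also have "\<dots> \<le> card ((V1 \<union> V2) - (P \<union> Q))"
    using fV fin by (intro card_mono) auto
  also have "\<dots> = card (V1 \<union> V2) - card (P \<union> Q)"
    using PQV finPQ by (simp add: card_Diff_subset)
  finally have "card (P \<inter> Q) \<le> card (V1 \<union> V2) - card (P \<union> Q)" .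
  moreover have "card (P \<union> Q) \<le> card (V1 \<union> V2)" using PQV fin by (intro card_mono)
  ultimately have card: "card P + card Q \<le> card (V1 \<union> V2)"
    using card_Un_Int[of P Q] finPQ by simp
  have MA: "\<not> E x y" if "x \<in> M" "y \<in> A" for x y
    using that MW unfolding A_def by blast
  have AA: "\<not> E x y" if "x \<in> A" "y \<in> A" for x y
    using that KK AK by blast
  show ?thesis
  proof (rule that[OF _ _ _ _ P2 Q2 card])
    show "P \<subseteq> V1 \<union> V2" "Q \<subseteq> V1 \<union> V2" using PQV by auto
    show "\<not> E x y" if "x \<in> P" "y \<in> P" for x y using that PK KK by blast
    show "\<not> E x y" if "x \<in> Q" "y \<in> Q" for x y
      using that AA AM MA MM unfolding Q_def by blast
  qed
qed

text \<open>Vertices without in-neighbours under \<open>E\<close> are left out of the third clause: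
  in the application they are within distance 2 of the sources of the whole digraph.\<close>

lemma small_set_within_two:
  assumes fin: "finite (V1 \<union> V2)" and disj: "V1 \<inter> V2 = {}"
    and kp1: "kernel_perfect_on E V1" and kp2: "kernel_perfect_on E V2"
    and closed: "\<And>u v. E u v \<Longrightarrow> u \<in> V1 \<union> V2 \<and> v \<in> V1 \<union> V2"
  obtains Q where "Q \<subseteq> V1 \<union> V2" "\<And>x y. x \<in> Q \<Longrightarrow> y \<in> Q \<Longrightarrow> \<not> E x y"
    "\<And>u v. E u v \<Longrightarrow> within_two E Q v" "2 * card Q \<le> card (V1 \<union> V2)"
proof -
  define U2 where "U2 = {v \<in> V2. \<exists>u\<in>V1. E u v}"
  define U1 where "U1 = V1 \<union> (V2 - U2)"
  have U: "U1 \<union> U2 = V1 \<union> V2" "U1 \<inter> U2 = {}" using disj by (auto simp: U1_def U2_def)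
  have "kernel_perfect_on E U1"
    unfolding U1_def
    by (intro kernel_perfect_on_Un kp1 kernel_perfect_on_subset[OF kp2]) (auto simp: U2_def)
  moreover have "kernel_perfect_on E U2"
    by (intro kernel_perfect_on_subset[OF kp2]) (auto simp: U2_def)
  moreover have "\<exists>u\<in>U1. E u v" if "v \<in> U2" for v using that by (auto simp: U1_def U2_def)
  ultimately obtain P Q where "P \<subseteq> V1 \<union> V2" "Q \<subseteq> V1 \<union> V2"
    "\<And>x y. x \<in> P \<Longrightarrow> y \<in> P \<Longrightarrow> \<not> E x y" "\<And>x y. x \<in> Q \<Longrightarrow> y \<in> Q \<Longrightarrow> \<not> E x y"
    "\<And>u v. E u v \<Longrightarrow> within_two E P v"
    "\<And>v. v \<in> V1 \<union> V2 \<Longrightarrow> within_two E Q v"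
    "card P + card Q \<le> card (V1 \<union> V2)"
    using two_sets_within_two[of U1 U2 E thesis] fin closed unfolding U by blast
  moreover from this have "2 * card P \<le> card (V1 \<union> V2) \<or> 2 * card Q \<le> card (V1 \<union> V2)"
    by linarith
  ultimately show ?thesis using that[of P] that[of Q] closed by blast
qed

section \<open>From distances to arcs and back\<close>

lemma set_distance_le_oneD:
  assumes "set_distance H K v \<le> 1" "v \<notin> K"
  obtains k where "k \<in> K" "k \<rightarrow>\<^bsub>H\<^esub> v"
proof -
  \<comment> \<open>Only a strict bound on an infimum yields a witness directly, so the bound 1 is
    first weakened to \<open>< 2\<close>.\<close>
  have "set_distance H K v < 2" using assms(1) by (rule le_less_trans) simp
  then obtain k p where k: "k \<in> K" and p: "pre_digraph.apath H k p v" "enat (length p) < 2"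
    unfolding set_distance_def distance_def INF_less_iff by auto
  have "length p < 2" using p(2) by (metis enat_ord_simps(2) numeral_eq_enat)
  moreover have "p \<noteq> []"
    using p(1) k assms(2)
    by (auto simp: pre_digraph.apath_def pre_digraph.awalk_def pre_digraph.cas.simps)
  ultimately obtain e where "p = [e]" by (cases p) auto
  then have "k \<rightarrow>\<^bsub>H\<^esub> v"
    using p(1)
    by (auto simp: pre_digraph.apath_def pre_digraph.awalk_def pre_digraph.cas.simps arcs_ends_conv)
  with k show ?thesis by (rule that)
qed

lemma (in loopfree_digraph) within_two_imp_set_distance_le_two:
  assumes "within_two (\<lambda>x y. x \<rightarrow>\<^bsub>G\<^esub> y) K v" "v \<notin> K"
  shows "set_distance G K v \<le> 2"
proof -
  have path: "set_distance G K v \<le> 2" if "k \<in> K" "apath k p v" "length p \<le> 2" for k p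
  proof -
    have "set_distance G K v \<le> distance G k v"
      unfolding set_distance_def using that(1) by (rule INF_lower)
    also have "\<dots> \<le> enat (length p)"
      unfolding distance_def using that(2) by (intro INF_lower) simp
    also have "\<dots> \<le> 2" using that(3) by (simp add: numeral_eq_enat)
    finally show ?thesis .
  qed
  consider k where "k \<in> K" "k \<rightarrow>\<^bsub>G\<^esub> v"
    | k w where "k \<in> K" "k \<rightarrow>\<^bsub>G\<^esub> w" "w \<rightarrow>\<^bsub>G\<^esub> v"
    using assms unfolding within_two_def by blast
  then show ?thesis
  proof cases
    case 1
    then obtain e where "e \<in> arcs G" "tail G e = k" "head G e = v" by blast
    then have "apath k [e] v"
      using no_loops[of e] by (auto simp: apath_def awalk_def)
    then show ?thesis using path 1 by fastforce
  next
    case 2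
    then obtain e e' where "e \<in> arcs G" "tail G e = k" "head G e = w"
      "e' \<in> arcs G" "tail G e' = w" "head G e' = v" by blast
    \<comment> \<open>An \<open>apath\<close> has distinct vertices: loops are excluded, and
      \<open>k\<close> differs from \<open>v\<close> because \<open>v\<close> is outside
      \<open>K\<close>.\<close>
    then have "apath k [e, e'] v"
      using no_loops[of e] no_loops[of e'] 2(1) assms(2) by (auto simp: apath_def awalk_def)
    then show ?thesis using path 2 by fastforce
  qed
qed

lemma (in wf_digraph) kernel_perfect_imp_kernel_perfect_on:
  assumes kp: "kernel_perfect (G \<restriction> V)" and V: "V \<subseteq> verts G"
    and E: "\<And>x y. x \<in> V \<Longrightarrow> y \<in> V \<Longrightarrow> E x y \<longleftrightarrow> x \<rightarrow>\<^bsub>G\<^esub> y"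
  shows "kernel_perfect_on E V"
  unfolding kernel_perfect_on_def
proof (intro allI impI)
  fix Y assume Y: "Y \<subseteq> V"
  have wf: "wf_digraph (G \<restriction> X)" for X
    by (unfold_locales) auto
  have "induced_subgraph (G \<restriction> Y) (G \<restriction> V)"
    using Y wf by (auto simp: induced_subgraph_def subgraph_def compatible_def)
  then obtain K where K: "is_kernel (G \<restriction> Y) K"
    using kp unfolding kernel_perfect_def by blast
  have arc: "x \<rightarrow>\<^bsub>G \<restriction> Y\<^esub> y \<longleftrightarrow> E x y" if "x \<in> Y" "y \<in> Y" for x y
    using that Y E[of x y] by (auto simp: arcs_ends_conv)
  have KY: "K \<subseteq> Y" using K by (auto simp: is_kernel_def indep_set_def)
  have "\<exists>k\<in>K. E k v" if v: "v \<in> Y - K" for v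
  proof -
    have "set_distance (G \<restriction> Y) K v \<le> 1" using K v by (simp add: is_kernel_def)
    then obtain k where "k \<in> K" "k \<rightarrow>\<^bsub>G \<restriction> Y\<^esub> v"
      using v by (blast elim: set_distance_le_oneD)
    then show ?thesis using arc KY v by blast
  qed
  moreover have "\<not> E x y" if "x \<in> K" "y \<in> K" for x y
    using K arc[of x y] KY that by (auto simp: is_kernel_def indep_set_def)
  ultimately show "\<exists>K. kernel_on E Y K" using KY unfolding kernel_on_def by blast
qed

lemma (in fin_digraph) not_source_iff:
  "v \<in> verts G \<Longrightarrow> v \<notin> sources G \<longleftrightarrow> (\<exists>u. u \<rightarrow>\<^bsub>G\<^esub> v)"
  by (auto simp: sources_def in_degree_def in_arcs_def arcs_ends_conv)

theorem theorem2:
  fixes D :: "('a, 'b) pre_digraph" and n :: nat and S V1 V2 :: "'a set"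
  assumes "digraph D"
    and "n = card (verts D)"
    and "S = sources D"
    and "V1 \<union> V2 = verts D - closed_out_nbrs D S"
    and "V1 \<inter> V2 = {}"
    and "kernel_perfect (D \<restriction> V1)"
    and "kernel_perfect (D \<restriction> V2)"
  shows "\<exists>K. is_quasi_kernel D K \<and>
    real (card K) \<le> (real n + real (card S) - real (card (set_out_nbrs D S))) / 2"
proof -
  interpret digraph D by fact
  define R where "R = V1 \<union> V2"
  define N where "N = set_out_nbrs D S"
  \<comment> \<open>Restricting the arcs to \<open>R\<close> makes the relation closed on
    \<open>V1 \<union> V2\<close>, as the lemma on small sets demands.\<close>
  define E where "E x y \<longleftrightarrow> x \<in> R \<and> y \<in> R \<and> x \<rightarrow>\<^bsub>D\<^esub> y" for x y
  have R: "R = verts D - (N \<union> S)"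
    unfolding R_def N_def assms(4) closed_out_nbrs_def ..
  have SV: "S \<subseteq> verts D" using assms(3) by (auto simp: sources_def)
  have NV: "N \<subseteq> verts D" "N \<inter> S = {}"
    by (auto simp: N_def set_out_nbrs_def out_nbrs_def)
  have into_S: "\<not> x \<rightarrow>\<^bsub>D\<^esub> y" if "y \<in> S" for x y
    using that not_source_iff[of y] assms(3) SV by blast
  have from_S: "y \<in> N" if "x \<in> S" "x \<rightarrow>\<^bsub>D\<^esub> y" for x y
    using that into_S by (auto simp: N_def set_out_nbrs_def out_nbrs_def)
  have to_N: "\<exists>x\<in>S. x \<rightarrow>\<^bsub>D\<^esub> y" if "y \<in> N" for y
    using that by (auto simp: N_def set_out_nbrs_def out_nbrs_def)
  have kp: "kernel_perfect_on E V1" "kernel_perfect_on E V2"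
    using assms(6,7) R
    by (auto intro!: kernel_perfect_imp_kernel_perfect_on simp: E_def R_def)
  have finR: "finite R" unfolding R by simp
  obtain Q where QR: "Q \<subseteq> R" and QQ: "\<And>x y. x \<in> Q \<Longrightarrow> y \<in> Q \<Longrightarrow> \<not> E x y"
    and Q2: "\<And>u v. E u v \<Longrightarrow> within_two E Q v" and cQ: "2 * card Q \<le> card R"
    using small_set_within_two[OF _ assms(5) kp] finR unfolding R_def E_def by blast
  have RV: "Q \<subseteq> verts D" "Q \<inter> N = {}" using QR R by auto
  have "\<not> x \<rightarrow>\<^bsub>D\<^esub> y" if "x \<in> S \<union> Q" "y \<in> S \<union> Q" for x y
  proof
    assume "x \<rightarrow>\<^bsub>D\<^esub> y"
    then have "y \<in> Q" "x \<in> Q" using that into_S from_S RV by blast+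
    then show False using QQ[of x y] QR \<open>x \<rightarrow>\<^bsub>D\<^esub> y\<close> by (auto simp: E_def)
  qed
  then have "indep_set D (S \<union> Q)"
    using SV RV by (auto simp: indep_set_def)
  moreover have "set_distance D (S \<union> Q) v \<le> 2" if v: "v \<in> verts D - (S \<union> Q)" for v
  proof (rule within_two_imp_set_distance_le_two)
    show "v \<notin> S \<union> Q" using v by blast
    obtain u where u: "u \<rightarrow>\<^bsub>D\<^esub> v" using v not_source_iff assms(3) by blast
    \<comment> \<open>A vertex of \<open>R\<close> without in-neighbours in \<open>R\<close> falls
      under \<open>u \<in> N\<close> and is reached from \<open>S\<close> through
      \<open>u\<close>.\<close>
    consider "u \<in> S" | "u \<in> N" | "v \<in> N" | "u \<in> R" "v \<in> R"
      using u v R adj_in_verts by blast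
    then show "within_two (\<lambda>x y. x \<rightarrow>\<^bsub>D\<^esub> y) (S \<union> Q) v"
    proof cases
      case 4
      then have "within_two E Q v" using u Q2 unfolding E_def by blast
      then show ?thesis unfolding within_two_def E_def by blast
    qed (use u to_N in \<open>unfold within_two_def, blast+\<close>)
  qed
  ultimately have "is_quasi_kernel D (S \<union> Q)" unfolding is_quasi_kernel_def by blast
  moreover have "real (card (S \<union> Q)) \<le> (real n + real (card S) - real (card N)) / 2"
  proof -
    have fin: "finite S" "finite N" using SV NV finite_subset[OF _ finite_verts] by auto
    have "verts D = R \<union> (N \<union> S)" "R \<inter> (N \<union> S) = {}" using R NV SV by blast+
    \<comment> \<open>Substituting this for \<open>n\<close> turns the target into
      \<open>card S + card R / 2\<close>.\<close>
    then have "n = card R + (card N + card S)"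
      using fin finR NV(2) assms(2) by (simp only: card_Un_disjoint finite_UnI)
    moreover have "card (S \<union> Q) \<le> card S + card Q" by (rule card_Un_le)
    ultimately show ?thesis using cQ by simp
  qed
  ultimately show ?thesis unfolding N_def by blast
qed

end
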